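(* Let $n\ge0$. For every polynomial $c(x)$ of degree at most $n$, putting $d=F_n^{-1}c$, one has $$F_n\big(d(-x-n-1)\big)=(-1)^nx^nc(1/x).$$ In matrix form: $F_nE^{n+1}(1,-x)F_n^{-1}=(-1)^nJ_n$, where $E^{k}$ is $c(x)\mapsto c(x+k)$, $(1,-x)$ is $c(x)\mapsto c(-x)$ and $J_nc(x)=x^nc(1/x)$.
   Context: Polynomials over $\mathbb{C}$; $(y)_p=y(y-1)\cdots(y-p+1)$, $[y]_k=y(y+1)\cdots(y+k-1)$. $F_n$ is the linear map on polynomials of degree at most $n$ given by $F_nx^p=(1-x)^{2n+1}\sum_{m\ge0}m^p\binom{m+n}{n}x^m$ ($0\le p\le n$, $0^0=1$); it is invertible with $F_n^{-1}x^p=\frac{n!}{(2n)!}(x)_p[x+n+1]_{n-p}$. *)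

theory Defs
  imports
    "HOL-Computational_Algebra.Computational_Algebra"
    "Jordan_Normal_Form.Matrix"
begin

definition polys_upto :: "nat \<Rightarrow> complex poly set" where
  "polys_upto n = {c. degree c \<le> n}"

text \<open>
  The right-hand side of the formula for \<open>F\<^sub>n x\<^sup>p\<close> is a formal power series; for \<open>p \<le> n\<close> it is
  a polynomial, and \<open>F_monom n p\<close> is that polynomial (unique, as \<^const>\<open>fps_of_poly\<close> is injective).
  Note that \<open>0 ^ 0 = 1\<close> in HOL.
\<close>

definition F_series :: "nat \<Rightarrow> nat \<Rightarrow> complex fps" where
  "F_series n p =
     (1 - fps_X) ^ (2 * n + 1) * Abs_fps (\<lambda>m. of_nat m ^ p * of_nat ((m + n) choose n))"

definition F_monom :: "nat \<Rightarrow> nat \<Rightarrow> complex poly" where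
  "F_monom n p = (THE q. fps_of_poly q = F_series n p)"

definition F_op :: "nat \<Rightarrow> complex poly \<Rightarrow> complex poly" where
  "F_op n c = (\<Sum>p\<le>n. Polynomial.smult (coeff c p) (F_monom n p))"

definition F_inv :: "nat \<Rightarrow> complex poly \<Rightarrow> complex poly" where
  "F_inv n = inv_into (polys_upto n) (F_op n)"

definition E_op :: "nat \<Rightarrow> complex poly \<Rightarrow> complex poly" where
  "E_op k c = pcompose c [:of_nat k, 1:]"

definition neg_op :: "complex poly \<Rightarrow> complex poly" where
  "neg_op c = pcompose c [:0, -1:]"

text \<open>
  \<open>x\<^sup>n c(1/x)\<close> for \<open>c\<close> of degree at most \<open>n\<close>, expanded into monomials; see \<open>poly_J_op\<close> below.
\<close>

definition J_op :: "nat \<Rightarrow> complex poly \<Rightarrow> complex poly" where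
  "J_op n c = (\<Sum>p\<le>n. monom (coeff c p) (n - p))"

lemma poly_J_op:
  assumes "degree c \<le> n" and "x \<noteq> 0"
  shows "poly (J_op n c) x = x ^ n * poly c (1 / x)"
proof -
  have "poly c (1 / x) = (\<Sum>p\<le>n. coeff c p * (1 / x) ^ p)"
    using poly_as_sum_of_monoms'[OF assms(1)]
    by (metis (no_types, lifting) poly_monom poly_sum sum.cong)
  then show ?thesis using assms(2)
    by (simp add: J_op_def poly_sum poly_monom sum_distrib_left power_diff power_divide
          mult.commute)
qed

text \<open>
  The matrix, with respect to \<open>1, x, \<dots>, x\<^sup>n\<close>, of an operator on polynomials of degree at most \<open>n\<close>:
  column \<open>j\<close> holds the coefficients of the image of \<open>x\<^sup>j\<close>.
\<close>

definition op_mat :: "nat \<Rightarrow> (complex poly \<Rightarrow> complex poly) \<Rightarrow> complex mat" where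
  "op_mat n T = mat (n + 1) (n + 1) (\<lambda>(i, j). coeff (T (monom 1 j)) i)"

end

theory Submission
  imports Defs
begin

text \<open>
  The map \<open>c \<mapsto> (1-x)\<^bsup>2n+1\<^esup> \<Sum>\<^sub>m c(m) binom(m+n,n) x\<^sup>m\<close> sends
  \<open>G\<^sub>p = n!/(2n)! (x)\<^sub>p [x+n+1]\<^bsub>n-p\<^esub>\<close> to \<open>x\<^sup>p\<close>.
  A polynomial \<open>c\<close> of degree at most \<open>n\<close> whose image starts with \<open>n+1\<close> zero coefficients vanishes
  at \<open>0, \<dots>, n\<close>, hence is zero; so the coefficients of the image of \<open>c\<close> are
  its coordinates in the \<open>G\<^sub>p\<close>. This gives \<open>F\<^sub>n\<close> and its inverse, and the
  substitution \<open>x \<mapsto> -x-n-1\<close> exchanges the linear factors \<open>-x\<close> and \<open>x+n+1\<close>, hence takes \<open>G\<^sub>p\<close> to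
  \<open>(-1)\<^sup>n G\<^bsub>n-p\<^esub>\<close>.
\<close>

no_notation vec_index (infixl "$" 100)

section \<open>Sums and rising factorials of polynomials\<close>

lemma smult_sum_right:
  "Polynomial.smult a (\<Sum>i\<in>A. f i) = (\<Sum>i\<in>A. Polynomial.smult a (f i))"
  by (induction A rule: infinite_finite_induct) (simp_all add: smult_add_right)

lemma poly_pochhammer: "poly (pochhammer p k) x = pochhammer (poly p x) k"
  by (simp add: pochhammer_prod poly_prod of_nat_poly)

lemma pcompose_pochhammer:
  fixes p r :: "'a :: comm_ring_1 poly"
  shows "pcompose (pochhammer p k) r = pochhammer (pcompose p r) k"
  by (simp add: pochhammer_prod pcompose_prod pcompose_add of_nat_poly)

lemma degree_pochhammer_le:
  fixes p :: "'a :: comm_ring_1 poly"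
  assumes "degree p \<le> 1"
  shows "degree (pochhammer p k) \<le> k"
proof -
  have "degree (pochhammer p k) \<le> (\<Sum>i=0..<k. degree (p + of_nat i))"
    unfolding pochhammer_prod using degree_prod_sum_le[of "{0..<k}" "\<lambda>i. p + of_nat i"]
    by (simp add: o_def)
  also have "\<dots> \<le> (\<Sum>i=0..<k. 1)"
    using assms by (intro sum_mono degree_add_le) (auto simp: of_nat_poly)
  finally show ?thesis by simp
qed

text \<open>This is the claimed \<open>F\<^sub>n\<^sup>-\<^sup>1 x\<^sup>p\<close>. The falling
  factorial is encoded as \<open>(-1) ^ p\<close> times the rising factorial of -x, so that both
  factors are instances of \<open>pochhammer\<close>.\<close>

definition F_preim :: "nat \<Rightarrow> nat \<Rightarrow> complex poly" where
  "F_preim n p = Polynomial.smult ((-1) ^ p * fact n / fact (2 * n))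
     (pochhammer [:0, -1:] p * pochhammer [:of_nat n + 1, 1:] (n - p))"

text \<open>For \<open>c = monom 1 p\<close> this is \<open>F_series n p\<close>. Using values of
  \<open>c\<close> instead of its coefficients lets the product form of \<open>F_preim\<close> be
  inserted directly.\<close>

definition eval_series :: "nat \<Rightarrow> complex poly \<Rightarrow> complex fps" where
  "eval_series n c =
     (1 - fps_X) ^ (2 * n + 1) * Abs_fps (\<lambda>m. poly c (of_nat m) * of_nat ((m + n) choose n))"

lemma F_preim_degree: "p \<le> n \<Longrightarrow> degree (F_preim n p) \<le> n"
proof -
  assume "p \<le> n"
  have "degree (F_preim n p) \<le> degree (pochhammer [:0, -1::complex:] p)
          + degree (pochhammer [:of_nat n + 1, 1::complex:] (n - p))"
    unfolding F_preim_def by (meson degree_mult_le degree_smult_le order_trans)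
  also have "\<dots> \<le> p + (n - p)"
    by (intro add_mono degree_pochhammer_le) auto
  finally show ?thesis using \<open>p \<le> n\<close> by simp
qed

lemma F_preim_combination_degree:
  "degree (\<Sum>p\<le>n. Polynomial.smult (a p) (F_preim n p)) \<le> n"
proof (rule degree_sum_le)
  show "degree (Polynomial.smult (a p) (F_preim n p)) \<le> n" if "p \<in> {..n}" for p
    using that order_trans[OF degree_smult_le F_preim_degree] by simp
qed simp

lemma F_preim_reflect:
  assumes "p \<le> n"
  shows "pcompose (F_preim n p) [:- of_nat n - 1, -1:]
           = Polynomial.smult ((-1) ^ n) (F_preim n (n - p))"
proof -
  \<comment> \<open>The reflected product carries the sign of index p, while
    \<open>F_preim n (n - p)\<close> carries that of n - p; they differ by
    \<open>(-1) ^ n\<close>.\<close>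
  have "(-1::complex) ^ p = (-1) ^ n * (-1) ^ (n - p)"
    using assms by (simp add: power_add[symmetric] minus_one_power_iff)
  moreover have "pcompose [:0, -1::complex:] [:- of_nat n - 1, -1:] = [:of_nat n + 1, 1:]"
    "pcompose [:of_nat n + 1, 1::complex:] [:- of_nat n - 1, -1:] = [:0, -1:]"
    by (simp_all add: pcompose_pCons)
  ultimately show ?thesis
    using assms by (simp add: F_preim_def pcompose_smult pcompose_mult pcompose_pochhammer mult_ac)
qed

text \<open>At an integer m the two products are quotients of factorials, and they cancel against
  the binomial coefficient. For m < p the first product contains the factor 0.\<close>

lemma poly_F_preim_of_nat:
  assumes "p \<le> n"
  shows "poly (F_preim n p) (of_nat m) * of_nat ((m + n) choose n)
           = (if m < p then 0 else of_nat ((2 * n + (m - p)) choose (m - p)))"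
proof (cases "m < p")
  case True
  then show ?thesis
    by (simp add: F_preim_def poly_pochhammer pochhammer_of_nat_eq_0_lemma)
next
  case False
  have "(of_nat (m choose p) :: complex) = (-1) ^ p * pochhammer (- of_nat m) p / fact p"
    by (simp add: binomial_gbinomial gbinomial_pochhammer)
  then have falling: "(-1) ^ p * pochhammer (- of_nat m :: complex) p = fact m / fact (m - p)"
    using False by (simp add: binomial_fact field_simps)
  \<comment> \<open>The argument on the left equals 2n + (m - p), because p is at most both m and
    n.\<close>
  have "(fact (m + n + (n - p)) :: complex)
          = fact (m + n) * pochhammer (1 + of_nat (m + n)) (n - p)"
    unfolding pochhammer_fact by (rule pochhammer_product')
  then have rising: "pochhammer (of_nat n + 1 + of_nat m :: complex) (n - p)
      = fact (2 * n + (m - p)) / fact (m + n)"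
    using False assms by (simp add: field_simps flip: mult_2)
  have "poly (F_preim n p) (of_nat m) =
      fact n / fact (2 * n) * (((-1) ^ p * pochhammer (- of_nat m) p)
        * pochhammer (of_nat n + 1 + of_nat m) (n - p))"
    by (simp add: F_preim_def poly_pochhammer)
  then show ?thesis
    using False unfolding falling rising by (simp add: binomial_fact field_simps)
qed

text \<open>The values just found are the coefficients of
  \<open>(1-x)\<^sup>-\<^sup>(\<^sup>2\<^sup>n\<^sup>+\<^sup>1\<^sup>)\<close> shifted by p, and the
  prefactor cancels this power.\<close>

lemma eval_series_F_preim:
  assumes "p \<le> n"
  shows "eval_series n (F_preim n p) = fps_X ^ p"
proof -
  let ?A = "Abs_fps (\<lambda>k. of_nat ((2 * n + k) choose k)) :: complex fps"
  have "Abs_fps (\<lambda>m. poly (F_preim n p) (of_nat m) * of_nat ((m + n) choose n)) = fps_X ^ p * ?A"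
    using poly_F_preim_of_nat[OF assms] by (intro fps_ext) (simp add: fps_X_power_mult_nth)
  moreover have "?A = inverse ((1 - fps_X) ^ (2 * n + 1))"
    using one_minus_const_fps_X_neg_power'[of "2 * n + 1" "1 :: complex"] by simp
  then have "(1 - fps_X) ^ (2 * n + 1) * ?A = 1"
    by (simp only:) (rule inverse_mult_eq_1', simp add: fps_nth_power_0)
  ultimately show ?thesis
    by (simp only: eval_series_def mult.left_commute[of _ "fps_X ^ p"] mult_1_right)
qed

section \<open>Linearity and injectivity of the series map\<close>

lemma eval_series_sum:
  "eval_series n (\<Sum>p\<in>A. Polynomial.smult (a p) (c p)) = (\<Sum>p\<in>A. fps_const (a p) * eval_series n (c p))"
proof -
  have "Abs_fps (\<lambda>m. poly (\<Sum>p\<in>A. Polynomial.smult (a p) (c p)) (of_nat m) * of_nat ((m + n) choose n))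
      = (\<Sum>p\<in>A. fps_const (a p) * Abs_fps (\<lambda>m. poly (c p) (of_nat m) * of_nat ((m + n) choose n)))"
    by (intro fps_ext) (simp add: poly_sum fps_sum_nth sum_distrib_left mult_ac)
  then show ?thesis
    by (simp add: eval_series_def sum_distrib_left mult_ac)
qed

text \<open>Division by the power of 1 - x is triangular: coefficients up to n of the quotient
  depend only on those up to n of the series. As the binomials are nonzero, \<open>c\<close> and
  \<open>d\<close> agree at n + 1 points.\<close>

lemma eval_series_low_inj:
  assumes "degree c \<le> n" "degree d \<le> n"
    and eq: "\<And>m. m \<le> n \<Longrightarrow> eval_series n c $ m = eval_series n d $ m"
  shows "c = d"
proof -
  define A where "A c = Abs_fps (\<lambda>m. poly c (of_nat m) * of_nat ((m + n) choose n))" for c :: "complex poly"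
  have A: "A c = inverse ((1 - fps_X) ^ (2 * n + 1)) * eval_series n c" for c
    unfolding A_def eval_series_def
    by (subst mult.assoc[symmetric], subst inverse_mult_eq_1) (simp_all add: fps_nth_power_0)
  have "A c $ m = A d $ m" if "m \<le> n" for m
    unfolding A fps_mult_nth using that by (intro sum.cong) (auto simp: eq)
  then have "poly c (of_nat m) = poly d (of_nat m)" if "m \<le> n" for m
    using that by (fastforce simp: A_def)
  moreover have "card (of_nat ` {..n} :: complex set) = n + 1"
    by (simp add: card_image)
  ultimately show ?thesis
    using assms(1,2) by (intro poly_eqI_degree[of "of_nat ` {..n}"]) auto
qed

lemma F_preim_expansion:
  assumes "degree c \<le> n"
  shows "c = (\<Sum>p\<le>n. Polynomial.smult (eval_series n c $ p) (F_preim n p))"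
proof (rule eval_series_low_inj[OF assms])
  show "degree (\<Sum>p\<le>n. Polynomial.smult (eval_series n c $ p) (F_preim n p)) \<le> n"
    by (rule F_preim_combination_degree)
  show "eval_series n c $ m =
      eval_series n (\<Sum>p\<le>n. Polynomial.smult (eval_series n c $ p) (F_preim n p)) $ m"
    if "m \<le> n" for m
    using that by (simp add: eval_series_sum eval_series_F_preim fps_sum_nth if_distrib cong: if_cong)
qed

text \<open>Applying the series map to the expansion in \<open>F_preim\<close> leaves only powers of
  x up to n. Hence the description in \<open>F_monom\<close> has a witness.\<close>

lemma eval_series_polynomial:
  assumes "degree c \<le> n"
  shows "eval_series n c = fps_of_poly (\<Sum>p\<le>n. monom (eval_series n c $ p) p)"
proof -
  have "eval_series n c = (\<Sum>p\<le>n. fps_const (eval_series n c $ p) * fps_X ^ p)"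
    by (subst F_preim_expansion[OF assms]) (simp add: eval_series_sum eval_series_F_preim)
  then show ?thesis by (simp add: fps_of_poly_sum fps_of_poly_monom)
qed

lemma fps_of_poly_F_monom:
  assumes "p \<le> n"
  shows "fps_of_poly (F_monom n p) = eval_series n (monom 1 p)"
proof -
  have "F_series n p = eval_series n (monom 1 p)"
    by (simp add: F_series_def eval_series_def poly_monom)
  also have "\<dots> = fps_of_poly (\<Sum>k\<le>n. monom (eval_series n (monom 1 p) $ k) k)"
    using assms by (intro eval_series_polynomial) (simp add: degree_monom_eq)
  finally have "\<exists>!q. fps_of_poly q = F_series n p"
    by (auto simp: fps_of_poly_eq_iff)
  then show ?thesis
    using \<open>F_series n p = eval_series n (monom 1 p)\<close> theI'[of "\<lambda>q. fps_of_poly q = F_series n p"]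
    by (simp add: F_monom_def)
qed

lemma fps_of_poly_F_op:
  assumes "degree c \<le> n"
  shows "fps_of_poly (F_op n c) = eval_series n c"
proof -
  have "fps_of_poly (F_op n c) = (\<Sum>p\<le>n. fps_const (coeff c p) * eval_series n (monom 1 p))"
    by (simp add: F_op_def fps_of_poly_sum fps_of_poly_smult fps_of_poly_F_monom)
  also have "\<dots> = eval_series n (\<Sum>p\<le>n. Polynomial.smult (coeff c p) (monom 1 p))"
    by (simp only: eval_series_sum)
  also have "(\<Sum>p\<le>n. Polynomial.smult (coeff c p) (monom 1 p)) = c"
    using poly_as_sum_of_monoms'[OF assms] by (simp add: smult_monom)
  finally show ?thesis .
qed

section \<open>The operator \<open>F_op\<close> and its inverse\<close>

lemma F_op_F_preim: "p \<le> n \<Longrightarrow> F_op n (F_preim n p) = monom 1 p"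
  using fps_of_poly_F_op[OF F_preim_degree, of p n]
  by (simp add: eval_series_F_preim fps_of_poly_monom'[symmetric] fps_of_poly_eq_iff)

lemma F_op_add: "F_op n (c + d) = F_op n c + F_op n d"
  by (simp add: F_op_def smult_add_left sum.distrib)

lemma F_op_smult: "F_op n (Polynomial.smult a c) = Polynomial.smult a (F_op n c)"
  by (simp add: F_op_def smult_sum_right)

lemma F_op_sum: "F_op n (\<Sum>p\<in>A. f p) = (\<Sum>p\<in>A. F_op n (f p))"
proof (induction A rule: infinite_finite_induct)
qed (simp_all add: F_op_add, simp_all add: F_op_def)

lemma F_op_inj: "inj_on (F_op n) (polys_upto n)"
proof (rule inj_onI)
  fix c d assume "c \<in> polys_upto n" "d \<in> polys_upto n" "F_op n c = F_op n d"
  then show "c = d"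
    using fps_of_poly_F_op[of c n] fps_of_poly_F_op[of d n]
    by (intro eval_series_low_inj[of c n d]) (simp_all add: polys_upto_def)
qed

lemma F_inv_eq:
  assumes "degree c \<le> n"
  shows "F_inv n c = (\<Sum>p\<le>n. Polynomial.smult (coeff c p) (F_preim n p))"
  unfolding F_inv_def
proof (rule inv_into_f_eq[OF F_op_inj])
  show "(\<Sum>p\<le>n. Polynomial.smult (coeff c p) (F_preim n p)) \<in> polys_upto n"
    unfolding polys_upto_def mem_Collect_eq by (rule F_preim_combination_degree)
  show "F_op n (\<Sum>p\<le>n. Polynomial.smult (coeff c p) (F_preim n p)) = c"
    using poly_as_sum_of_monoms'[OF assms]
    by (simp add: F_op_sum F_op_smult F_op_F_preim smult_monom)
qed

lemma F_inv_degree: "degree c \<le> n \<Longrightarrow> degree (F_inv n c) \<le> n"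
  by (simp add: F_inv_eq F_preim_combination_degree)

text \<open>Each term of the expansion of \<open>F_inv n c\<close> is reflected from index p to n -
  p, and \<open>F_op n\<close> turns it into the monomial of degree n - p, which is the reversal
  \<open>J_op\<close>.\<close>

lemma F_op_reflect_F_inv:
  assumes "degree c \<le> n"
  shows "F_op n (pcompose (F_inv n c) [:- of_nat n - 1, -1:]) = Polynomial.smult ((-1) ^ n) (J_op n c)"
proof -
  have "pcompose (F_inv n c) [:- of_nat n - 1, -1:]
      = (\<Sum>p\<le>n. Polynomial.smult (coeff c p) (Polynomial.smult ((-1) ^ n) (F_preim n (n - p))))"
    by (simp add: F_inv_eq[OF assms] pcompose_sum pcompose_smult F_preim_reflect)
  then show ?thesis
    by (simp add: F_op_sum F_op_smult F_op_F_preim smult_monom J_op_def smult_sum_right mult.commute)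
qed

text \<open>The bound on \<open>U\<close> ensures that column j records all of
  \<open>U (monom 1 j)\<close>; linearity of \<open>T\<close> then gives the product.\<close>

lemma op_mat_mult:
  assumes add: "\<And>c d. T (c + d) = T c + T d"
    and smult: "\<And>a c. T (Polynomial.smult a c) = Polynomial.smult a (T c)"
    and deg: "\<And>j. j \<le> n \<Longrightarrow> degree (U (monom 1 j)) \<le> n"
  shows "op_mat n T * op_mat n U = op_mat n (\<lambda>c. T (U c))"
proof (rule eq_matI)
  have T0: "T 0 = 0" using smult[of 0 0] by simp
  have T_sum: "T (sum f A) = (\<Sum>k\<in>A. T (f k))" for f and A :: "nat set"
    by (induction A rule: infinite_finite_induct) (simp_all add: add T0)
  fix i j assume "i < dim_row (op_mat n (\<lambda>c. T (U c)))" "j < dim_col (op_mat n (\<lambda>c. T (U c)))"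
  then have ij: "i \<le> n" "j \<le> n" by (simp_all add: op_mat_def)
  have "T (U (monom 1 j)) = T (\<Sum>k\<le>n. Polynomial.smult (coeff (U (monom 1 j)) k) (monom 1 k))"
    using poly_as_sum_of_monoms'[OF deg[OF ij(2)]] by (simp add: smult_monom)
  also have "\<dots> = (\<Sum>k\<le>n. Polynomial.smult (coeff (U (monom 1 j)) k) (T (monom 1 k)))"
    by (simp add: T_sum smult)
  finally have "coeff (T (U (monom 1 j))) i
      = (\<Sum>k\<le>n. coeff (T (monom 1 k)) i * coeff (U (monom 1 j)) k)"
    by (simp add: coeff_sum mult.commute)
  then show "(op_mat n T * op_mat n U) $$ (i, j) = op_mat n (\<lambda>c. T (U c)) $$ (i, j)"
    using ij by (simp add: op_mat_def scalar_prod_def atLeast0LessThan lessThan_Suc_atMost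
        del: sum.lessThan_Suc)
qed (simp_all add: op_mat_def)

theorem theorem3p1:
  fixes n :: nat
  shows "(\<forall>c \<in> polys_upto n. let d = F_inv n c in
            F_op n (pcompose d [:- of_nat n - 1, -1:]) = Polynomial.smult ((-1) ^ n) (J_op n c))
       \<and> op_mat n (F_op n) * op_mat n (E_op (n + 1)) * op_mat n neg_op * op_mat n (F_inv n)
           = (-1) ^ n \<cdot>\<^sub>m op_mat n (J_op n)"
proof
  show "\<forall>c \<in> polys_upto n. let d = F_inv n c in
      F_op n (pcompose d [:- of_nat n - 1, -1:]) = Polynomial.smult ((-1) ^ n) (J_op n c)"
    by (simp add: polys_upto_def F_op_reflect_F_inv)
  have pcompose_monom_degree: "degree (pcompose (monom 1 j) [:a, b:]) \<le> n"
    if "j \<le> n" for j and a b :: complex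
  proof -
    have "degree (pcompose (monom 1 j) [:a, b:]) \<le> degree (monom (1::complex) j) * degree [:a, b:]"
      by (rule degree_pcompose_le)
    also have "\<dots> \<le> j * 1" by (intro mult_mono degree_monom_le) auto
    finally show ?thesis using that by simp
  qed
  \<comment> \<open>The composite grows from the left as \<open>T\<close>, and
    \<open>F_inv n\<close> enters only as the last \<open>U\<close>, through its degree
    bound.\<close>
  have "op_mat n (F_op n) * op_mat n (E_op (n + 1)) = op_mat n (\<lambda>c. F_op n (E_op (n + 1) c))"
    by (intro op_mat_mult)
      (auto simp: F_op_add F_op_smult E_op_def intro: pcompose_monom_degree)
  also have "\<dots> * op_mat n neg_op = op_mat n (\<lambda>c. F_op n (E_op (n + 1) (neg_op c)))"
    by (intro op_mat_mult)
      (auto simp: F_op_add F_op_smult E_op_def neg_op_def pcompose_add pcompose_smult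
        intro: pcompose_monom_degree)
  also have "\<dots> * op_mat n (F_inv n) = op_mat n (\<lambda>c. F_op n (E_op (n + 1) (neg_op (F_inv n c))))"
    by (intro op_mat_mult)
      (auto simp: F_op_add F_op_smult E_op_def neg_op_def pcompose_add pcompose_smult
        intro!: F_inv_degree degree_monom_le[THEN order_trans])
  also have "\<dots> = (-1) ^ n \<cdot>\<^sub>m op_mat n (J_op n)"
  proof (rule eq_matI)
    fix i j assume "i < dim_row ((-1) ^ n \<cdot>\<^sub>m op_mat n (J_op n))"
      "j < dim_col ((-1) ^ n \<cdot>\<^sub>m op_mat n (J_op n))"
    then have ij: "i \<le> n" "j \<le> n" by (simp_all add: op_mat_def)
    \<comment> \<open>The negation acts first: d(-x) shifted by n + 1 is d(-(x+n+1)).\<close>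
    have "E_op (n + 1) (neg_op d) = pcompose d [:- of_nat n - 1, -1:]" for d
      unfolding diff_conv_add_uminus add.commute[of "- of_nat n"]
      by (simp add: E_op_def neg_op_def pcompose_assoc[symmetric] pcompose_pCons)
    then have "F_op n (E_op (n + 1) (neg_op (F_inv n (monom 1 j))))
        = Polynomial.smult ((-1) ^ n) (J_op n (monom 1 j))"
      using F_op_reflect_F_inv[of "monom 1 j" n] ij(2) by (simp add: degree_monom_eq)
    then show "op_mat n (\<lambda>c. F_op n (E_op (n + 1) (neg_op (F_inv n c)))) $$ (i, j)
        = ((-1) ^ n \<cdot>\<^sub>m op_mat n (J_op n)) $$ (i, j)"
      using ij by (simp add: op_mat_def)
  qed (simp_all add: op_mat_def)
  finally show "op_mat n (F_op n) * op_mat n (E_op (n + 1)) * op_mat n neg_op * op_mat n (F_inv n)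
      = (-1) ^ n \<cdot>\<^sub>m op_mat n (J_op n)" .
qed

end
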